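(* Let $P_1, P_2 \in \mathcal{D}_{\geq 1} \cap M$ be absolutely continuous (with respect to Lebesgue measure), with densities $f, g$, respectively. (1) If there is some $x_0 \geq 1$ such that on the interval $[x_0, \infty)$ we have $f \leq g$ almost everywhere, but not $f = g$ almost everywhere, then $P_1 \prec_{\text{tail}} P_2$. (2) If there are $x_0 \geq 1$ and $\delta > 0$ such that $f \leq g$ on $[x_0, \infty)$ and $f < g$ on $[x_0, x_0 + \delta]$, then $P_1 \prec_{\text{tail}} P_2$.
   Context: $\mathcal{D}$ is the set of Borel probability measures on $\mathbb{R}$; $\mathcal{D}_{\geq 1}$ is the subset of those whose support is contained in $[1,\infty)$. $M$ is the set of $P \in \mathcal{D}$ with $\int |x|^k \, dP(x) < \infty$ for all $k \in \mathbb{N}$; for $P\in M$ and $k \in \mathbb{N}_0$ let $m_k(P) = \int x^k \, dP(x)$. The stochastic tail order on $\mathcal{D}$ is defined by: $P_1 \preccurlyeq_{\text{tail}} P_2$ iff $P_1 = P_2$, or ($P_1, P_2 \in M$ and $m_k(P_1) \leq m_k(P_2)$ for all but finitely many $k \in \mathbb{N}_0$). $P_1 \prec_{\text{tail}} P_2$ means $P_1 \preccurlyeq_{\text{tail}} P_2$ and not $P_2 \preccurlyeq_{\text{tail}} P_1$. *)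

theory Defs
  imports "HOL-Probability.Probability"
begin

definition borel_probs :: "real measure set" where
  "borel_probs = {P. real_distribution P}"

definition msupport :: "real measure \<Rightarrow> real set" where
  "msupport P = {x. \<forall>U. open U \<longrightarrow> x \<in> U \<longrightarrow> emeasure P U > 0}"

definition borel_probs_ge1 :: "real measure set" where
  "borel_probs_ge1 = {P \<in> borel_probs. msupport P \<subseteq> {1..}}"

definition finite_moments :: "real measure set" where
  "finite_moments = {P \<in> borel_probs. \<forall>k::nat. integrable P (\<lambda>x. \<bar>x\<bar> ^ k)}"

definition moment :: "nat \<Rightarrow> real measure \<Rightarrow> real" where
  "moment k P = (\<integral>x. x ^ k \<partial>P)"

text \<open>The order lives on \<^term>\<open>borel_probs\<close>; since it is a predicate on the whole type
  \<^typ>\<open>real measure\<close>, membership of both arguments is part of the definition.\<close>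

definition tail_le :: "real measure \<Rightarrow> real measure \<Rightarrow> bool" (infix "\<preceq>tail" 50) where
  "P1 \<preceq>tail P2 \<longleftrightarrow> P1 \<in> borel_probs \<and> P2 \<in> borel_probs \<and>
     (P1 = P2 \<or>
      (P1 \<in> finite_moments \<and> P2 \<in> finite_moments \<and>
       finite {k. \<not> moment k P1 \<le> moment k P2}))"

definition tail_less :: "real measure \<Rightarrow> real measure \<Rightarrow> bool" (infix "\<prec>tail" 50) where
  "P1 \<prec>tail P2 \<longleftrightarrow> P1 \<preceq>tail P2 \<and> \<not> P2 \<preceq>tail P1"

text \<open>Nonnegativity has to be demanded explicitly, because \<^const>\<open>ennreal\<close> maps negative
  numbers to 0.\<close>

definition lebesgue_density :: "real measure \<Rightarrow> (real \<Rightarrow> real) \<Rightarrow> bool" where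
  "lebesgue_density P f \<longleftrightarrow> f \<in> borel_measurable borel \<and> (\<forall>x. 0 \<le> f x) \<and>
     P = density lborel (\<lambda>x. ennreal (f x))"

end

theory Submission
  imports Defs
begin

text \<open>On \<open>[1, x0)\<close> the difference of the densities can cost the \<open>k\<close>-th moment of \<open>P2\<close> at most \<open>x0 ^ k\<close>.
  Since the densities differ on a non-null subset of \<open>[x0, \<infinity>)\<close>, the integral \<open>c\<close> of \<open>g - f\<close> over
  \<open>[x1, \<infinity>)\<close> is positive for some \<open>x1 > x0\<close>, which gains at least \<open>c * x1 ^ k\<close>. The gain
  outgrows the cost because \<open>x1 > x0\<close>.\<close>

text \<open>Each point outside the support has an open neighbourhood of measure 0, so the complement
  is the union of all open null sets. That family may be uncountable; the Lindelof property replaces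
  it by a countable subfamily with the same union.\<close>

lemma compl_msupport_null:
  assumes "sets P = sets borel"
  shows "- msupport P \<in> null_sets P"
proof -
  define F where "F = {U. open U \<and> U \<in> null_sets P}"
  have "\<And>U. U \<in> F \<Longrightarrow> open U"
    by (auto simp: F_def)
  then obtain F' where F': "F' \<subseteq> F" "countable F'" "\<Union>F' = \<Union>F"
    by (rule Lindelof)
  have "\<Union>F' \<in> null_sets P"
    using F' by (intro null_sets_UN'[where N = "\<lambda>U. U", simplified]) (auto simp: F_def)
  moreover have "- msupport P = \<Union>F"
    using assms by (auto simp: msupport_def F_def null_sets_def)
  ultimately show ?thesis
    using F' by simp
qed

text \<open>This turns the support condition into a statement about the density, which removes the
  region \<open>x < 1\<close> from the moment integrals. There the sign of \<open>x ^ k\<close> may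
  depend on \<open>k\<close>.\<close>

lemma density_zero_below_1:
  assumes "P \<in> borel_probs_ge1" "lebesgue_density P f"
  shows "AE x in lborel. x < 1 \<longrightarrow> f x = 0"
proof -
  have f: "f \<in> borel_measurable borel" "\<And>x. 0 \<le> f x" and P: "P = density lborel (\<lambda>x. ennreal (f x))"
    using assms(2) by (auto simp: lebesgue_density_def)
  have "- msupport P \<in> null_sets P"
    by (rule compl_msupport_null) (simp add: P)
  then have "AE x in P. 1 \<le> x"
    using assms(1) by (rule_tac AE_I') (auto simp: borel_probs_ge1_def)
  then have "AE x in lborel. 0 < ennreal (f x) \<longrightarrow> 1 \<le> x"
    unfolding P using f by (subst (asm) AE_density) auto
  then show ?thesis
    by eventually_elim (use f(2) in \<open>force simp: less_le\<close>)
qed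

lemma integrable_power_density:
  assumes "P \<in> finite_moments" "lebesgue_density P f"
  shows "integrable lborel (\<lambda>x. f x * x ^ k)"
proof -
  have f: "f \<in> borel_measurable borel" "\<And>x. 0 \<le> f x" and P: "P = density lborel (\<lambda>x. ennreal (f x))"
    using assms(2) by (auto simp: lebesgue_density_def)
  have "integrable P (\<lambda>x. \<bar>x ^ k\<bar>)"
    using assms(1) by (simp add: finite_moments_def power_abs)
  then have "integrable P (\<lambda>x. x ^ k)"
    by (rule integrable_abs_cancel) (simp add: P)
  then show ?thesis
    unfolding P using f by (subst (asm) integrable_density) auto
qed

lemma moment_density:
  assumes "lebesgue_density P f"
  shows "moment k P = (\<integral>x. f x * x ^ k \<partial>lborel)"
proof -
  have f: "f \<in> borel_measurable borel" "\<And>x. 0 \<le> f x" and P: "P = density lborel (\<lambda>x. ennreal (f x))"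
    using assms by (auto simp: lebesgue_density_def)
  show ?thesis
    unfolding moment_def P using f by (subst integral_density) auto
qed

lemma moment_0:
  assumes "P \<in> borel_probs"
  shows "moment 0 P = 1"
proof -
  interpret real_distribution P
    using assms by (simp add: borel_probs_def)
  show ?thesis
    by (simp add: moment_def prob_space[simplified])
qed

text \<open>Otherwise \<open>h\<close> would vanish almost everywhere on every ray starting strictly
  to the right of \<open>x0\<close>, hence on \<open>[x0, \<infinity>)\<close>. The inequality
  \<open>x0 < x1\<close> has to be strict, since it is what separates the powers of
  \<open>x1\<close> from those of \<open>x0\<close>.\<close>

lemma tail_integral_pos:
  fixes h :: "real \<Rightarrow> real"
  assumes h: "integrable lborel h"
    and nonneg: "AE x in lborel. x \<in> {x0..} \<longrightarrow> 0 \<le> h x"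
    and nonzero: "\<not> (AE x in lborel. x \<in> {x0..} \<longrightarrow> h x = 0)"
  obtains x1 where "x0 < x1" "0 < (\<integral>x. indicator {x1..} x * h x \<partial>lborel)"
proof (rule ccontr)
  assume contr: "\<not> thesis"
  \<comment> \<open>The rays \<open>{y n..}\<close> are countably many and exhaust
    \<open>(x0, \<infinity>)\<close>, so their null sets can be combined; the endpoint
    \<open>x0\<close> is itself a null set.\<close>
  define y where "y n = x0 + 1 / real (Suc n)" for n
  have y: "x0 < y n" for n
    by (simp add: y_def)
  have "AE x in lborel. indicator {y n..} x * h x = 0" for n
  proof -
    have nn: "AE x in lborel. 0 \<le> indicator {y n..} x * h x"
      using nonneg by eventually_elim (use y[of n] in \<open>auto simp: indicator_def\<close>)
    have "\<not> 0 < (\<integral>x. indicator {y n..} x * h x \<partial>lborel)"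
      using contr that[OF y] by blast
    moreover have "0 \<le> (\<integral>x. indicator {y n..} x * h x \<partial>lborel)"
      using nn by (rule integral_nonneg_AE)
    ultimately have "(\<integral>x. indicator {y n..} x * h x \<partial>lborel) = 0"
      by simp
    moreover have "integrable lborel (\<lambda>x. indicator {y n..} x * h x)"
      using integrable_real_mult_indicator[OF _ h, of "{y n..}"] by (simp add: mult.commute)
    ultimately show ?thesis
      using integral_nonneg_eq_0_iff_AE[OF _ nn] by simp
  qed
  then have "AE x in lborel. \<forall>n. indicator {y n..} x * h x = 0"
    by (subst AE_all_countable) blast
  moreover have "AE x in lborel. x \<noteq> x0"
    by (rule AE_lborel_singleton)
  ultimately have "AE x in lborel. x \<in> {x0..} \<longrightarrow> h x = 0"
  proof eventually_elim
    case (elim x)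
    show ?case
    proof
      assume "x \<in> {x0..}"
      with elim have "0 < x - x0"
        by simp
      then obtain n where "1 / real (Suc n) < x - x0"
        using nat_approx_posE by blast
      then have "y n \<le> x"
        by (simp add: y_def)
      then show "h x = 0"
        using elim(1)[rule_format, of n] by simp
    qed
  qed
  with nonzero show False
    by simp
qed

text \<open>Eventual strictness gives the order in one direction and excludes both ways in which the
  converse could hold: equality of the measures, and the reverse inequality of moments for all large
  \<open>k\<close>.\<close>

lemma tail_less_if_eventually_moment_less:
  assumes "P1 \<in> finite_moments" "P2 \<in> finite_moments"
    and less: "\<forall>\<^sub>F k in sequentially. moment k P1 < moment k P2"
  shows "P1 \<prec>tail P2"
proof -
  \<comment> \<open>On the naturals, a finite set of exceptions is the same as validity from some
    index on.\<close>
  have fin: "finite {k. \<not> moment k Q \<le> moment k Q'} \<longleftrightarrow>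
      (\<forall>\<^sub>F k in sequentially. moment k Q \<le> moment k Q')" for Q Q'
    by (simp add: cofinite_eq_sequentially[symmetric] eventually_cofinite)
  have "P1 \<noteq> P2"
    using less by auto
  moreover have "\<not> (\<forall>\<^sub>F k in sequentially. moment k P2 \<le> moment k P1)"
  proof
    assume "\<forall>\<^sub>F k in sequentially. moment k P2 \<le> moment k P1"
    with less have "\<forall>\<^sub>F k in sequentially. False"
      by eventually_elim simp
    then show False
      by simp
  qed
  moreover have "\<forall>\<^sub>F k in sequentially. moment k P1 \<le> moment k P2"
    using less by eventually_elim simp
  ultimately show ?thesis
    using assms(1,2) unfolding tail_less_def tail_le_def fin
    by (auto simp: finite_moments_def)
qed

text \<open>After division by \<open>b ^ k\<close> this is the convergence of
  \<open>(a / b) ^ k\<close> to 0.\<close>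

lemma eventually_power_less_mult_power:
  fixes a b c :: real
  assumes "0 < a" "a < b" "0 < c"
  shows "\<forall>\<^sub>F k in sequentially. a ^ k < c * b ^ k"
proof -
  have "(\<lambda>k. (a / b) ^ k) \<longlonglongrightarrow> 0"
    using assms by (intro LIMSEQ_power_zero) simp
  then have "\<forall>\<^sub>F k in sequentially. (a / b) ^ k < c"
    using assms(3) by (rule order_tendstoD)
  then show ?thesis
    by eventually_elim (use assms in \<open>simp add: power_divide divide_simps\<close>)
qed

lemma tail_less_if_densities_AE_le:
  assumes P1: "P1 \<in> borel_probs_ge1 \<inter> finite_moments"
    and P2: "P2 \<in> borel_probs_ge1 \<inter> finite_moments"
    and f: "lebesgue_density P1 f" and g: "lebesgue_density P2 g"
    and x0: "1 \<le> x0"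
    and le: "AE x in lborel. x \<in> {x0..} \<longrightarrow> f x \<le> g x"
    and neq: "\<not> (AE x in lborel. x \<in> {x0..} \<longrightarrow> f x = g x)"
  shows "P1 \<prec>tail P2"
proof -
  have nonneg: "0 \<le> f x" "0 \<le> g x" for x
    using f g by (auto simp: lebesgue_density_def)
  have int_f: "integrable lborel (\<lambda>x. f x * x ^ k)" for k
    using P1 f by (intro integrable_power_density) auto
  have int_g: "integrable lborel (\<lambda>x. g x * x ^ k)" for k
    using P2 g by (intro integrable_power_density) auto
  have int_h: "integrable lborel (\<lambda>x. g x - f x)"
    using Bochner_Integration.integrable_diff[OF int_g[of 0] int_f[of 0]] by simp
  have "AE x in lborel. x \<in> {x0..} \<longrightarrow> 0 \<le> g x - f x"
    using le by simp
  moreover have "\<not> (AE x in lborel. x \<in> {x0..} \<longrightarrow> g x - f x = 0)"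
    using neq by (simp add: eq_commute[of "g _"])
  ultimately obtain x1 where x1: "x0 < x1"
    and pos: "0 < (\<integral>x. indicator {x1..} x * (g x - f x) \<partial>lborel)"
    by (rule tail_integral_pos[OF int_h])
  define c where "c = (\<integral>x. indicator {x1..} x * (g x - f x) \<partial>lborel)"
  have int_ind: "integrable lborel (\<lambda>x. indicator {x1..} x * (g x - f x))"
    using integrable_real_mult_indicator[OF _ int_h, of "{x1..}"] by (simp add: mult.commute)
  \<comment> \<open>The 0-th moment is the total mass, which gives the cost term
    \<open>x0 ^ k\<close> its coefficient 1.\<close>
  have total_f: "(\<integral>x. f x \<partial>lborel) = 1"
    using moment_0[of P1] moment_density[OF f, of 0] P1 by (simp add: borel_probs_ge1_def)
  have bound: "x1 ^ k * c - x0 ^ k \<le> moment k P2 - moment k P1" for k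
  proof -
    \<comment> \<open>Gain and cost are written as one integral over the whole line, so that a
      pointwise comparison of integrands suffices.\<close>
    have "x1 ^ k * c - x0 ^ k =
        (\<integral>x. x1 ^ k * (indicator {x1..} x * (g x - f x)) - x0 ^ k * f x \<partial>lborel)"
      using int_ind int_f[of 0] by (subst Bochner_Integration.integral_diff) (auto simp: total_f c_def)
    also have "\<dots> \<le> (\<integral>x. g x * x ^ k - f x * x ^ k \<partial>lborel)"
    proof (rule integral_mono_AE)
      show "integrable lborel (\<lambda>x. x1 ^ k * (indicator {x1..} x * (g x - f x)) - x0 ^ k * f x)"
        using int_ind int_f[of 0] by (intro Bochner_Integration.integrable_diff) auto
      show "integrable lborel (\<lambda>x. g x * x ^ k - f x * x ^ k)"
        using int_f int_g by auto
      have f0: "AE x in lborel. x < 1 \<longrightarrow> f x = 0" and g0: "AE x in lborel. x < 1 \<longrightarrow> g x = 0"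
        using density_zero_below_1 P1 P2 f g by auto
      from f0 g0 le
      show "AE x in lborel. x1 ^ k * (indicator {x1..} x * (g x - f x)) - x0 ^ k * f x
          \<le> g x * x ^ k - f x * x ^ k"
      proof eventually_elim
        case (elim x)
        \<comment> \<open>The cost is incurred on \<open>[1, x0)\<close>, but subtracting this
          nonnegative term elsewhere as well only lowers the left side.\<close>
        have cost: "0 \<le> x0 ^ k * f x"
          using x0 nonneg by simp
        \<comment> \<open>Below 1 both densities vanish; on \<open>[1, x0)\<close> the contribution
          of \<open>g\<close> is bounded below by 0; on \<open>[x0, x1)\<close> the right side is
          nonnegative; from \<open>x1\<close> on, \<open>x ^ k\<close> is at least
          \<open>x1 ^ k\<close>.\<close>
        consider "x < 1" | "1 \<le> x" "x < x0" | "x0 \<le> x" "x < x1" | "x1 \<le> x"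
          by linarith
        then show ?case
        proof cases
          case 1
          then show ?thesis
            using elim x0 x1 by simp
        next
          case 2
          then have "f x * x ^ k \<le> x0 ^ k * f x"
            using nonneg by (subst mult.commute) (auto intro!: mult_right_mono power_mono)
          moreover have "0 \<le> g x * x ^ k"
            using 2 nonneg by simp
          ultimately show ?thesis
            using 2 x1 by simp
        next
          case 3
          then have "f x * x ^ k \<le> g x * x ^ k"
            using elim x0 by (intro mult_right_mono) auto
          with 3 cost show ?thesis
            by simp
        next
          case 4
          then have "x1 ^ k * (g x - f x) \<le> x ^ k * (g x - f x)"
            using elim x0 x1 by (intro mult_right_mono power_mono) auto
          with 4 cost show ?thesis
            by (simp add: algebra_simps)
        qed
      qed
    qed
    also have "\<dots> = moment k P2 - moment k P1"
      using int_f int_g by (simp add: moment_density[OF f] moment_density[OF g])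
    finally show ?thesis .
  qed
  have "\<forall>\<^sub>F k in sequentially. x0 ^ k < c * x1 ^ k"
    using x0 x1 pos by (intro eventually_power_less_mult_power) (auto simp: c_def)
  then have "\<forall>\<^sub>F k in sequentially. moment k P1 < moment k P2"
  proof eventually_elim
    case (elim k)
    then show ?case
      using bound[of k] by (simp add: mult.commute)
  qed
  then show ?thesis
    using P1 P2 by (intro tail_less_if_eventually_moment_less) auto
qed

text \<open>A nondegenerate interval has positive Lebesgue measure. This lets the strict inequality
  in (2) refute equality almost everywhere, so that (2) becomes an instance of (1).\<close>

lemma not_AE_lborel_on_interval:
  fixes a b :: real
  assumes "a < b" and not: "\<And>x. x \<in> {a..b} \<Longrightarrow> \<not> Q x"
  shows "\<not> (AE x in lborel. Q x)"
proof
  assume "AE x in lborel. Q x"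
  then have "AE x in lborel. x \<notin> {a..b}"
    by eventually_elim (use not in blast)
  then have "{a..b} \<in> null_sets lborel"
    by (subst AE_iff_null_sets) auto
  with \<open>a < b\<close> show False
    by (simp add: null_sets_def)
qed

theorem theorem4p17:
  fixes P1 P2 :: "real measure" and f g :: "real \<Rightarrow> real"
  assumes "P1 \<in> borel_probs_ge1 \<inter> finite_moments"
    and "P2 \<in> borel_probs_ge1 \<inter> finite_moments"
    and "absolutely_continuous lborel P1" and "absolutely_continuous lborel P2"
    and "lebesgue_density P1 f" and "lebesgue_density P2 g"
  shows "((\<exists>x0\<ge>1. (AE x in lborel. x \<in> {x0..} \<longrightarrow> f x \<le> g x) \<and>
              \<not> (AE x in lborel. x \<in> {x0..} \<longrightarrow> f x = g x))
            \<longrightarrow> P1 \<prec>tail P2) \<and>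
         ((\<exists>x0\<ge>1. \<exists>\<delta>>0. (\<forall>x\<in>{x0..}. f x \<le> g x) \<and> (\<forall>x\<in>{x0..x0+\<delta>}. f x < g x))
            \<longrightarrow> P1 \<prec>tail P2)"
proof (intro conjI impI; elim exE conjE)
  fix x0 :: real
  assume "1 \<le> x0" "AE x in lborel. x \<in> {x0..} \<longrightarrow> f x \<le> g x"
    "\<not> (AE x in lborel. x \<in> {x0..} \<longrightarrow> f x = g x)"
  with assms(1,2,5,6) show "P1 \<prec>tail P2"
    by (rule tail_less_if_densities_AE_le)
next
  fix x0 \<delta> :: real
  assume x0: "1 \<le> x0" and "0 < \<delta>" and le: "\<forall>x\<in>{x0..}. f x \<le> g x"
    and less: "\<forall>x\<in>{x0..x0 + \<delta>}. f x < g x"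
  have "AE x in lborel. x \<in> {x0..} \<longrightarrow> f x \<le> g x"
    using le by simp
  moreover have "\<not> (AE x in lborel. x \<in> {x0..} \<longrightarrow> f x = g x)"
    using \<open>0 < \<delta>\<close> less by (intro not_AE_lborel_on_interval[of x0 "x0 + \<delta>"]) force+
  ultimately show "P1 \<prec>tail P2"
    by (rule tail_less_if_densities_AE_le[OF assms(1,2,5,6) x0])
qed

end
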